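(* For all sufficiently large integers $k$, setting $b=\frac{k+1}{4(k+1)^2-1}$ and $a=\frac{1-(2k+1)b}{2}$, the system $[1/2_s: a,a,b,\ldots,b]$ with two players of weight $a$ and $2k+1$ players of weight $b$ is a primitive Shapley-Shubik fixed point.
   Context: For real numbers $a_1,\ldots,a_N\ge 0$ with sum $1$, $V=[1/2_s: a_1,\ldots,a_N]$ denotes the weighted voting system with $N$ players, player $i$ having weight $a_i$, in which a coalition (set of players) is winning if and only if the sum of the weights of its members strictly exceeds $1/2$. Shapley-Shubik power index: for each of the $N!$ orderings of the players, the pivotal player is the one whose weight, when weights are added up from the beginning of the ordering, first makes the partial sum strictly exceed $1/2$. The Shapley-Shubik index of a player is the number of orderings in which it is pivotal divided by $N!$. Let $SS(V)$ be the tuple of Shapley-Shubik indices of players $1,\ldots,N$. $V$ is a Shapley-Shubik fixed point if $SS(V)=(a_1,\ldots,a_N)$. A fixed point is primitive if no player $i$ has $a_i=0$. *)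

theory Defs
  imports Complex_Main "HOL-Combinatorics.Multiset_Permutations"
begin

text \<open>
  The system \<open>[1/2_s: a_1, ..., a_N]\<close> is represented by its list of weights;
  the players are the list positions \<open>0, ..., N - 1\<close>.
\<close>

definition voting_system :: "real list \<Rightarrow> bool" where
  "voting_system w \<longleftrightarrow> (\<forall>x\<in>set w. x \<ge> 0) \<and> sum_list w = 1"

definition players :: "real list \<Rightarrow> nat set" where
  "players w = {..<length w}"

definition winning :: "real list \<Rightarrow> nat set \<Rightarrow> bool" where
  "winning w C \<longleftrightarrow> (\<Sum>i\<in>C. w ! i) > 1/2"

definition orderings :: "real list \<Rightarrow> nat list set" where
  "orderings w = permutations_of_set (players w)"

text \<open>
  Player \<open>i\<close>, at position \<open>m\<close> of the ordering \<open>xs\<close>, is the first one whose arrival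
  makes the coalition of the players so far winning.
\<close>

definition pivotal :: "real list \<Rightarrow> nat list \<Rightarrow> nat \<Rightarrow> bool" where
  "pivotal w xs i \<longleftrightarrow>
     (\<exists>m<length xs. xs ! m = i \<and> winning w (set (take (Suc m) xs)) \<and>
        (\<forall>l\<le>m. \<not> winning w (set (take l xs))))"

lemma winning_take_iff_partial_sum:
  assumes "xs \<in> orderings w"
  shows "winning w (set (take m xs)) \<longleftrightarrow> (\<Sum>i\<leftarrow>take m xs. w ! i) > 1/2"
proof -
  have "distinct xs"
    using assms by (simp add: orderings_def permutations_of_setD)
  then show ?thesis
    by (simp add: winning_def sum_list_distinct_conv_sum_set)
qed

definition SS_index :: "real list \<Rightarrow> nat \<Rightarrow> real" where
  "SS_index w i = real (card {xs \<in> orderings w. pivotal w xs i}) / fact (length w)"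

definition SS :: "real list \<Rightarrow> real list" where
  "SS w = map (SS_index w) [0..<length w]"

definition SS_fixed_point :: "real list \<Rightarrow> bool" where
  "SS_fixed_point w \<longleftrightarrow> voting_system w \<and> SS w = w"

definition primitive_SS_fixed_point :: "real list \<Rightarrow> bool" where
  "primitive_SS_fixed_point w \<longleftrightarrow> SS_fixed_point w \<and> (\<forall>i\<in>players w. w ! i \<noteq> 0)"

end

(* Put n = k + 1. With these weights a coalition wins iff it contains both large players, or
   one large player and at least n of the 2n - 1 small ones. By Shapley's formula the index of a
   player is the sum of |S|! (N - |S| - 1)! / N! over the coalitions S that the player turns
   from losing to winning. A small player swings one large player together with n - 1 of the
   other small ones; a large player swings, for every set T of small players, exactly one of
   T and T with the other large player added. *)
theory Submission
  imports Defs
begin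

section \<open>From orderings to coalitions: Shapley's formula\<close>

definition swings :: "real list \<Rightarrow> nat \<Rightarrow> nat set set" where
  "swings w i = {S. S \<subseteq> players w - {i} \<and> \<not> winning w S \<and> winning w (insert i S)}"

text \<open>An ordering in which exactly the players of \<open>S\<close> precede \<open>i\<close> is
  a permutation of \<open>S\<close>, then \<open>i\<close>, then a permutation of the remaining
  players. Gluing these pieces by \<open>?f\<close> is a bijection from \<open>?P\<close> onto the
  set counted, whence the two factorials.\<close>

lemma card_permutations_with_predecessors:
  assumes fin: "finite A" and i: "i \<in> A" and S: "S \<subseteq> A - {i}"
  shows "card {xs \<in> permutations_of_set A. \<exists>m<length xs. xs ! m = i \<and> set (take m xs) = S}
           = fact (card S) * fact (card A - card S - 1)"
proof -
  let ?R = "A - insert i S"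
  let ?P = "permutations_of_set S \<times> permutations_of_set ?R"
  let ?f = "\<lambda>(ys, zs). ys @ i # zs"
  let ?X = "{xs \<in> permutations_of_set A. \<exists>m<length xs. xs ! m = i \<and> set (take m xs) = S}"
  have finS: "finite S" and iS: "i \<notin> S" using S fin by (auto intro: finite_subset)
  have "inj_on ?f ?P"
  proof (rule inj_onI, clarify)
    fix ys zs ys' zs'
    assume "ys \<in> permutations_of_set S" "ys' \<in> permutations_of_set S"
      and eq: "ys @ i # zs = ys' @ i # zs'"
    \<comment> \<open>Both lists permute \<open>S\<close>, so \<open>i\<close> stands at the same
      position on each side and the two lists can be cut there.\<close>
    then have "length ys = length ys'"
      by (simp add: length_finite_permutations_of_set)
    then show "ys = ys' \<and> zs = zs'" using eq by auto
  qed
  moreover have "?f ` ?P = ?X"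
  proof
    show "?f ` ?P \<subseteq> ?X"
    proof clarify
      fix ys zs
      assume ys: "ys \<in> permutations_of_set S" and zs: "zs \<in> permutations_of_set ?R"
      have "ys @ i # zs \<in> permutations_of_set A"
        using ys zs S i iS by (auto simp: permutations_of_set_def)
      moreover have "set ys = S" using ys by (simp add: permutations_of_setD)
      ultimately show "ys @ i # zs \<in> permutations_of_set A \<and>
          (\<exists>m<length (ys @ i # zs). (ys @ i # zs) ! m = i \<and> set (take m (ys @ i # zs)) = S)"
        by (auto intro!: exI[of _ "length ys"])
    qed
    show "?X \<subseteq> ?f ` ?P"
    proof clarify
      fix xs m
      assume xs: "xs \<in> permutations_of_set A" and m: "m < length xs"
        and im: "i = xs ! m" and Sm: "S = set (take m xs)"
      have split: "xs = take m xs @ xs ! m # drop (Suc m) xs"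
        using m by (rule id_take_nth_drop)
      have d: "distinct xs" and sA: "set xs = A"
        using xs by (auto simp: permutations_of_set_def)
      have "distinct (take m xs @ xs ! m # drop (Suc m) xs)"
        and "set (take m xs @ xs ! m # drop (Suc m) xs) = A"
        using d sA split by simp_all
      then have "drop (Suc m) xs \<in> permutations_of_set (A - insert (xs ! m) (set (take m xs)))"
        unfolding permutations_of_set_def by auto
      moreover have "take m xs \<in> permutations_of_set (set (take m xs))"
        using d by (simp add: permutations_of_set_def)
      ultimately show "xs \<in> (\<lambda>(ys, zs). ys @ xs ! m # zs) `
          (permutations_of_set (set (take m xs)) \<times>
           permutations_of_set (A - insert (xs ! m) (set (take m xs))))"
        using split by (intro image_eqI[of _ _ "(take m xs, drop (Suc m) xs)"]) auto
    qed
  qed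
  moreover have "card ?R = card A - card S - 1"
    using fin finS i S iS by (subst card_Diff_subset) auto
  ultimately show ?thesis
    using fin finS card_image[of ?f ?P] by (simp add: card_cartesian_product)
qed

lemma winning_mono:
  assumes "\<forall>x\<in>set w. x \<ge> 0" "C \<subseteq> D" "D \<subseteq> players w" "winning w C"
  shows "winning w D"
proof -
  have "finite D" using assms(3) by (auto simp: players_def intro: finite_subset)
  then have "(\<Sum>i\<in>C. w ! i) \<le> (\<Sum>i\<in>D. w ! i)"
    using assms by (intro sum_mono2) (auto simp: players_def)
  then show ?thesis using assms(4) by (simp add: winning_def)
qed

text \<open>With nonnegative weights winning passes to supersets, so no prefix before
  \<open>i\<close> wins as soon as the longest one, the set of all predecessors of \<open>i\<close>,
  loses. Pivotality thus depends on the ordering only through that set.\<close>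

lemma pivotal_iff_swing:
  assumes "\<forall>x\<in>set w. x \<ge> 0" and xs: "xs \<in> orderings w"
  shows "pivotal w xs i \<longleftrightarrow> (\<exists>S\<in>swings w i. \<exists>m<length xs. xs ! m = i \<and> set (take m xs) = S)"
proof -
  have dist: "distinct xs" and set_xs: "set xs = players w"
    using xs by (auto simp: orderings_def permutations_of_set_def)
  have sub: "set (take m xs) \<subseteq> players w" for m
    using set_take_subset[of m xs] set_xs by simp
  have "winning w (set (take (Suc m) xs)) \<and> (\<forall>l\<le>m. \<not> winning w (set (take l xs)))
      \<longleftrightarrow> set (take m xs) \<in> swings w i"
    if m: "m < length xs" "xs ! m = i" for m
  proof -
    have "i \<notin> set (take m xs)"
      using dist m by (auto simp: in_set_conv_nth nth_eq_iff_index_eq)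
    then have "set (take m xs) \<subseteq> players w - {i}" using sub[of m] by auto
    moreover have "set (take (Suc m) xs) = insert i (set (take m xs))"
      using m by (simp add: take_Suc_conv_app_nth)
    moreover have "\<not> winning w (set (take l xs))"
      if "l \<le> m" "\<not> winning w (set (take m xs))" for l
      using that sub winning_mono[OF assms(1) set_take_subset_set_take] by blast
    ultimately show ?thesis unfolding swings_def by auto
  qed
  then show ?thesis unfolding pivotal_def by blast
qed

text \<open>The orderings in which \<open>i\<close> is pivotal are sorted by the predecessor set
  \<open>S\<close> of \<open>i\<close>, which ranges over the swings; each class has the size
  computed above.\<close>

theorem SS_index_Shapley:
  assumes nn: "\<forall>x\<in>set w. x \<ge> 0" and i: "i \<in> players w"
  shows "SS_index w i =
    (\<Sum>S\<in>swings w i. fact (card S) * fact (length w - card S - 1)) / fact (length w)"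
proof -
  let ?X = "\<lambda>S. {xs \<in> orderings w. \<exists>m<length xs. xs ! m = i \<and> set (take m xs) = S}"
  have fin: "finite (players w)" by (simp add: players_def)
  have finsw: "finite (swings w i)"
    by (rule finite_subset[of _ "Pow (players w)"]) (auto simp: swings_def players_def)
  have "{xs \<in> orderings w. pivotal w xs i} = (\<Union>S\<in>swings w i. ?X S)"
    using pivotal_iff_swing[OF nn] by auto
  moreover have "card (\<Union>S\<in>swings w i. ?X S) = (\<Sum>S\<in>swings w i. card (?X S))"
  proof (rule card_UN_disjoint[OF finsw])
    show "\<forall>S\<in>swings w i. finite (?X S)" by (simp add: orderings_def)
    \<comment> \<open>A player occurs only once in an ordering, so its position, and with it the
      predecessor set, is determined.\<close>
    have "S = T" if "xs \<in> ?X S" "xs \<in> ?X T" for xs S T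
    proof -
      have "distinct xs" using that by (auto simp: orderings_def permutations_of_set_def)
      then show ?thesis using that by (auto simp: nth_eq_iff_index_eq)
    qed
    then show "\<forall>S\<in>swings w i. \<forall>T\<in>swings w i. S \<noteq> T \<longrightarrow> ?X S \<inter> ?X T = {}" by blast
  qed
  moreover have "card (?X S) = fact (card S) * fact (length w - card S - 1)"
    if "S \<in> swings w i" for S
    using card_permutations_with_predecessors[OF fin i, of S] that
    by (simp add: orderings_def swings_def players_def)
  ultimately show ?thesis by (simp add: SS_index_def)
qed

section \<open>Two summation identities\<close>

lemma sum_Pow_card:
  fixes f :: "nat \<Rightarrow> real"
  assumes "finite A"
  shows "(\<Sum>T\<in>Pow A. f (card T)) = (\<Sum>m\<le>card A. real (card A choose m) * f m)"
proof -
  have "(\<Sum>T\<in>Pow A. f (card T)) = (\<Sum>m\<le>card A. \<Sum>T\<in>{T\<in>Pow A. card T = m}. f (card T))"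
    using assms by (intro sum.group[symmetric]) (auto intro: card_mono)
  also have "\<dots> = (\<Sum>m\<le>card A. real (card A choose m) * f m)"
  proof (rule sum.cong[OF refl])
    fix m
    have "(\<Sum>T\<in>{T\<in>Pow A. card T = m}. f (card T)) = (\<Sum>T\<in>{T. T \<subseteq> A \<and> card T = m}. f m)"
      by (rule sum.cong) auto
    then show "(\<Sum>T\<in>{T\<in>Pow A. card T = m}. f (card T)) = real (card A choose m) * f m"
      using n_subsets[OF assms, of m] by simp
  qed
  finally show ?thesis .
qed

text \<open>Shifted by \<open>n\<close>, the second half has terms \<open>n - m\<close>; added to
  the terms \<open>m + 1\<close> of the first half, each gives \<open>n + 1\<close>, and there are
  \<open>n\<close> such pairs. This sum remains in the index of a large player once the binomials
  have cancelled.\<close>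

lemma sum_min_reflect:
  "(\<Sum>m<2 * n. if m < n then real m + 1 else 2 * real n - real m) = real n * (real n + 1)"
proof -
  let ?g = "\<lambda>m. if m < n then real m + 1 else 2 * real n - real m"
  have "(\<Sum>m<2 * n. ?g m) = (\<Sum>m<n. ?g m) + (\<Sum>m=n..<2 * n. ?g m)"
    using sum.atLeastLessThan_concat[of 0 n "2 * n" ?g] by (simp only: lessThan_atLeast0)
  also have "(\<Sum>m=n..<2 * n. ?g m) = (\<Sum>m<n. ?g (m + n))"
    using sum.shift_bounds_nat_ivl[of ?g 0 n n] by (simp only: add_0 mult_2 lessThan_atLeast0)
  also have "\<dots> = (\<Sum>m<n. real n - real m)"
    by (rule sum.cong) auto
  also have "(\<Sum>m<n. ?g m) + (\<Sum>m<n. real n - real m) = (\<Sum>m<n. real n + 1)"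
    by (subst sum.distrib[symmetric]) (rule sum.cong, auto)
  finally show ?thesis by (simp add: algebra_simps)
qed

section \<open>Weights and winning coalitions of the system\<close>

text \<open>Here \<open>n\<close> stands for \<open>k + 1\<close>, and \<open>a\<close> has the
  closed form that the index computation will produce; that the weights sum to 1 is then derived in
  \<open>sum_weights\<close>.\<close>

locale two_large_players =
  fixes n :: nat and a b :: real and w :: "real list"
  assumes n_pos: "n \<ge> 1"
    and b_eq: "b = real n / (4 * (real n)\<^sup>2 - 1)"
    and a_eq: "a = (real n + 1) / (2 * (2 * real n + 1))"
    and w_eq: "w = [a, a] @ replicate (2 * n - 1) b"
begin

abbreviation "small \<equiv> {2..<2 * n + 1}"

lemma length_w [simp]: "length w = 2 * n + 1"
  using n_pos by (simp add: w_eq)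

lemma players_w: "players w = {0, 1} \<union> small"
  using n_pos by (auto simp: players_def)

lemma nth_large: "c \<in> {0, 1} \<Longrightarrow> w ! c = a"
  by (auto simp: w_eq)

lemma nth_small: "j \<in> small \<Longrightarrow> w ! j = b"
  using n_pos by (auto simp: w_eq nth_append nth_Cons split: nat.splits)

lemma denom_pos: "4 * (real n)\<^sup>2 - 1 > 0"
proof -
  have "1 \<le> (real n)\<^sup>2" using n_pos by simp
  then show ?thesis by linarith
qed

lemma a_pos: "a > 0" and b_pos: "b > 0"
  using n_pos denom_pos by (auto simp: a_eq b_eq)

text \<open>Factoring the denominator of \<open>b\<close> shows that the small players hold
  \<open>n / (2 * n + 1)\<close> in all, and the two large ones
  \<open>(n + 1) / (2 * n + 1)\<close>.\<close>

lemma sum_weights: "2 * a + (2 * real n - 1) * b = 1"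
proof -
  have "4 * (real n)\<^sup>2 - 1 = (2 * real n - 1) * (2 * real n + 1)"
    by (simp add: power2_eq_square algebra_simps)
  moreover have "2 * real n - 1 \<noteq> 0" "2 * real n + 1 \<noteq> 0" using n_pos by auto
  ultimately have "(2 * real n - 1) * b = real n / (2 * real n + 1)" by (simp add: b_eq)
  moreover have "2 * a = (real n + 1) / (2 * real n + 1)"
    unfolding a_eq by (simp only: times_divide_eq_right mult_divide_mult_cancel_left_if) simp
  ultimately show ?thesis
    using \<open>2 * real n + 1 \<noteq> 0\<close> by (simp add: add_divide_distrib[symmetric])
qed

lemma half_bounds: "2 * a > 1/2" "(2 * real n - 1) * b < 1/2"
proof -
  show "2 * a > 1/2" by (simp add: a_eq field_simps)
  then show "(2 * real n - 1) * b < 1/2" using sum_weights by linarith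
qed

lemma nonneg: "\<forall>x\<in>set w. x \<ge> 0"
  using a_pos b_pos by (auto simp: w_eq)

lemma voting_system: "voting_system w"
proof -
  have "sum_list w = 2 * a + (2 * real n - 1) * b"
    using n_pos by (simp add: w_eq sum_list_replicate of_nat_diff)
  then show ?thesis using sum_weights nonneg by (simp add: voting_system_def)
qed

text \<open>The large pair holds more than half, so all small players together hold less. For one
  large player, \<open>2 * a = 1 - (2 * n - 1) * b\<close> turns the winning condition into a
  comparison of multiples of \<open>b\<close>.\<close>

lemma winning_small:
  assumes "T \<subseteq> small"
  shows "\<not> winning w T"
    and "c \<in> {0, 1} \<Longrightarrow> winning w (insert c T) \<longleftrightarrow> n \<le> card T"
    and "winning w (insert 0 (insert 1 T))"
proof -
  have fin: "finite T" using assms by (rule finite_subset) simp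
  have nin: "0 \<notin> T" "1 \<notin> T" using assms by auto
  have cT: "card T \<le> 2 * n - 1" using card_mono[OF _ assms] by simp
  have sumT: "(\<Sum>i\<in>T. w ! i) = real (card T) * b"
    using assms nth_small by (simp add: subset_iff)
  have "real (card T) * b \<le> (2 * real n - 1) * b"
    using cT n_pos b_pos by (intro mult_right_mono) linarith+
  then show "\<not> winning w T" using half_bounds sumT by (simp add: winning_def)
  have "real (card T) * b \<ge> 0" using b_pos by simp
  then show "winning w (insert 0 (insert 1 T))"
    using fin nin half_bounds nth_large sumT by (simp add: winning_def)
  assume c: "c \<in> {0, 1}"
  then have "(\<Sum>i\<in>insert c T. w ! i) = a + real (card T) * b"
    using fin nin nth_large sumT by auto
  then have "winning w (insert c T) \<longleftrightarrow> 1/2 < a + real (card T) * b"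
    by (simp add: winning_def)
  also have "\<dots> \<longleftrightarrow> (2 * real n - 1) * b < 2 * (real (card T) * b)"
    using sum_weights by (intro iffI) linarith+
  also have "\<dots> \<longleftrightarrow> (2 * real n - 1) * b < 2 * real (card T) * b"
    by (simp only: mult.assoc)
  \<comment> \<open>Between integers, \<open>2 * n - 1 < 2 * card T\<close> amounts to
    \<open>n \<le> card T\<close>, as the left side is odd.\<close>
  also have "\<dots> \<longleftrightarrow> n \<le> card T" using b_pos by (simp add: mult_less_cancel_right) linarith
  finally show "winning w (insert c T) \<longleftrightarrow> n \<le> card T" .
qed

section \<open>The swings of large and small players\<close>

text \<open>Without \<open>c\<close>, the coalitions with small part \<open>T\<close> are
  \<open>T\<close> and \<open>insert d T\<close>. If \<open>card T < n\<close>, adding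
  \<open>c\<close> to \<open>T\<close> still loses, while \<open>insert d T\<close> loses and wins
  with \<open>c\<close>. Otherwise \<open>insert d T\<close> already wins, while \<open>T\<close>
  loses and wins with \<open>c\<close>.\<close>

lemma swings_large:
  assumes "{c, d} = {0, 1}" "c \<noteq> d"
  shows "swings w c = (\<lambda>T. if card T < n then insert d T else T) ` Pow small"
proof (intro set_eqI iffI)
  have cd: "c \<in> {0, 1}" "d \<in> {0, 1}" using assms by auto
  have both: "insert c (insert d T) = insert 0 (insert 1 T)" for T
    using assms by (metis insert_is_Un sup_assoc)
  have csmall: "c \<notin> small" using cd by auto
  fix S
  {
    assume "S \<in> (\<lambda>T. if card T < n then insert d T else T) ` Pow small"
    then obtain T where T: "T \<subseteq> small" "S = (if card T < n then insert d T else T)" by auto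
    have "S \<subseteq> players w - {c}"
      using T csmall assms(2) cd by (auto simp: players_w)
    moreover have "\<not> winning w S" "winning w (insert c S)"
      using T winning_small[OF T(1)] cd both by auto
    ultimately show "S \<in> swings w c" by (simp add: swings_def)
  }
  assume "S \<in> swings w c"
  then have S: "S \<subseteq> players w - {c}" "\<not> winning w S" "winning w (insert c S)"
    by (auto simp: swings_def)
  define T where "T = S \<inter> small"
  have T: "T \<subseteq> small" by (simp add: T_def)
  have dS: "S = insert d T \<or> S = T"
    using S(1) assms unfolding players_w T_def by blast
  have "S = (if card T < n then insert d T else T)"
    using dS S winning_small[OF T] cd by auto
  then show "S \<in> (\<lambda>T. if card T < n then insert d T else T) ` Pow small" using T by blast
qed

text \<open>A small player matters only beside exactly one large player, where it must raise the
  number of small members from \<open>n - 1\<close> to the quota \<open>n\<close>.\<close>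

lemma swings_small:
  assumes j: "j \<in> small"
  shows "swings w j = (\<lambda>(c, T). insert c T) ` ({0, 1} \<times> {T. T \<subseteq> small - {j} \<and> card T = n - 1})"
proof (intro set_eqI iffI)
  have j01: "j \<noteq> 0" "j \<noteq> 1" using j by auto
  have card_j: "card (insert j T) = Suc (card T)" if "T \<subseteq> small - {j}" for T
    using that finite_subset[OF that] by (subst card_insert_disjoint) auto
  fix S
  {
    assume "S \<in> (\<lambda>(c, T). insert c T) ` ({0, 1} \<times> {T. T \<subseteq> small - {j} \<and> card T = n - 1})"
    then obtain c T where cT: "c \<in> {0, 1}" "T \<subseteq> small - {j}" "card T = n - 1" "S = insert c T"
      by auto
    have sub: "T \<subseteq> small" "insert j T \<subseteq> small" using cT j by auto
    have "S \<subseteq> players w - {j}" using cT j01 by (auto simp: players_w)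
    moreover have "\<not> winning w S" "winning w (insert j S)"
      using winning_small(2)[OF sub(1) cT(1)] winning_small(2)[OF sub(2) cT(1)] cT n_pos
        card_j[OF cT(2)] by (auto simp: insert_commute)
    ultimately show "S \<in> swings w j" by (simp add: swings_def)
  }
  assume "S \<in> swings w j"
  then have S: "S \<subseteq> players w - {j}" "\<not> winning w S" "winning w (insert j S)"
    by (auto simp: swings_def)
  define T where "T = S \<inter> small"
  have T: "T \<subseteq> small - {j}" and sub: "T \<subseteq> small" "insert j T \<subseteq> small"
    using S(1) j by (auto simp: T_def)
  \<comment> \<open>Of the three cases, no large player loses even with \<open>j\<close>, and both
    large players win already without \<open>j\<close>.\<close>
  have "S = T \<or> (\<exists>c\<in>{0, 1}. S = insert c T) \<or> S = insert 0 (insert 1 T)"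
    using S(1) unfolding players_w T_def by blast
  then obtain c where c: "c \<in> {0, 1}" "S = insert c T"
    using S winning_small(1)[OF sub(2)] winning_small(3)[OF sub(1)] by auto
  have "card T = n - 1"
    using winning_small(2)[OF sub(1) c(1)] winning_small(2)[OF sub(2) c(1)] S c
      card_j[OF T] by (simp add: insert_commute)
  then show "S \<in> (\<lambda>(c, T). insert c T) ` ({0, 1} \<times> {T. T \<subseteq> small - {j} \<and> card T = n - 1})"
    using c T by (intro image_eqI[of _ _ "(c, T)"]) auto
qed

section \<open>The indices and the fixed point\<close>

text \<open>Each swing has \<open>n\<close> members and leaves \<open>n\<close> players after
  \<open>j\<close>, so it contributes the square of \<open>fact n\<close>. The factorials in the
  central binomial coefficient cancel, leaving
  \<open>2 * n^2 / ((2 * n + 1) * (2 * n) * (2 * n - 1))\<close>, which is \<open>b\<close>.\<close>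

lemma SS_index_small:
  assumes j: "j \<in> small"
  shows "SS_index w j = b"
proof -
  let ?F = "{T. T \<subseteq> small - {j} \<and> card T = n - 1}"
  \<comment> \<open>With \<open>n = k + 1\<close> there are \<open>2 * k\<close> small players other
    than \<open>j\<close>, of which a swing takes \<open>k\<close>.\<close>
  obtain k where k: "n = Suc k" using n_pos by (cases n) auto
  have inj: "inj_on (\<lambda>(c, T). insert c T) ({0, 1} \<times> ?F)"
  proof (rule inj_onI, clarify)
    fix c T c' T'
    assume c: "c \<in> {0, 1::nat}" "c' \<in> {0, 1::nat}" and T: "T \<subseteq> small - {j}" "T' \<subseteq> small - {j}"
      and eq: "insert c T = insert c' T'"
    have nin: "c \<notin> T" "c \<notin> T'" using c T by auto
    have "c \<in> insert c' T'" using eq by blast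
    then have "c = c'" using nin by simp
    then show "c = c' \<and> T = T'" using eq nin by (simp add: insert_ident)
  qed
  have card_F: "card ?F = (2 * k) choose k"
    using j k by (subst n_subsets) auto
  have card_S: "card S = n" if "S \<in> swings w j" for S
  proof -
    from that obtain c T where "c \<in> {0, 1}" "T \<subseteq> small - {j}" "card T = n - 1" "S = insert c T"
      unfolding swings_small[OF j] by auto
    moreover from this have "finite T" "c \<notin> T" by (auto intro: finite_subset)
    ultimately show ?thesis using n_pos by simp
  qed
  have "card (swings w j) = 2 * ((2 * k) choose k)"
    unfolding swings_small[OF j] by (simp only: card_image[OF inj] card_cartesian_product card_F) simp
  then have "(\<Sum>S\<in>swings w j. fact (card S) * fact (length w - card S - 1))
      = real (2 * ((2 * k) choose k)) * (fact n * fact n)"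
    using card_S by simp
  also have "\<dots> = 2 * (real n)\<^sup>2 * (fact k * fact k * real ((2 * k) choose k))"
    by (simp add: k power2_eq_square algebra_simps)
  also have "fact k * fact k * real ((2 * k) choose k) = fact (2 * k)"
  proof -
    have "fact k * fact k * ((2 * k) choose k) = fact (2 * k)"
      using binomial_fact_lemma[of k "2 * k"] by simp
    then show ?thesis by (metis of_nat_fact of_nat_mult)
  qed
  finally have "SS_index w j = 2 * (real n)\<^sup>2 * fact (2 * k) / fact (2 * n + 1)"
    using j by (subst SS_index_Shapley[OF nonneg]) (auto simp: players_w)
  also have "fact (2 * n + 1) = (2 * real n + 1) * (2 * real n) * (2 * real n - 1) * fact (2 * k)"
    by (simp add: k algebra_simps)
  also have "2 * (real n)\<^sup>2 * fact (2 * k) / \<dots> = b"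
  proof -
    have "4 * (real n)\<^sup>2 - 1 = (2 * real n + 1) * (2 * real n - 1)"
      by (simp add: power2_eq_square algebra_simps)
    moreover have "2 * real n - 1 \<noteq> 0" "real n \<noteq> 0" using n_pos by auto
    ultimately show ?thesis by (simp add: b_eq power2_eq_square)
  qed
  finally show ?thesis .
qed

text \<open>Multiplying the factorial weight by the number of sets \<open>T\<close> of size
  \<open>m\<close> leaves \<open>fact (2 * n - 1)\<close> times a linear factor; summing these
  factors gives \<open>n * (n + 1)\<close>, and dividing by \<open>fact (2 * n + 1)\<close> gives
  \<open>a\<close>.\<close>

lemma SS_index_large:
  assumes c: "c \<in> {0, 1}"
  shows "SS_index w c = a"
proof -
  obtain d where d: "{c, d} = {0, 1}" "c \<noteq> d"
    using c by (metis doubleton_eq_iff insertE singletonD zero_neq_one)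
  have d01: "d \<in> {0, 1}" using d by auto
  have dsmall: "d \<notin> T" if "T \<subseteq> small" for T using d01 that by auto
  have finT: "finite T" if "T \<subseteq> small" for T using that by (rule finite_subset) simp
  let ?h = "\<lambda>T. if card T < n then insert d T else T"
  \<comment> \<open>The swing belonging to \<open>T\<close> has \<open>m + 1\<close> or
    \<open>m\<close> members, according to whether \<open>d\<close> was added; the second factorial
    counts the orders of the players after \<open>c\<close>.\<close>
  let ?f = "\<lambda>m. if m < n then fact (m + 1) * fact (2 * n - 1 - m)
                 else fact m * fact (2 * n - m) :: real"
  \<comment> \<open>As \<open>d\<close> is not small, deleting it recovers \<open>T\<close>.\<close>
  have inj: "inj_on ?h (Pow small)"
  proof (rule inj_on_inverseI)
    show "?h T - {d} = T" if "T \<in> Pow small" for T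
      using that dsmall[of T] by auto
  qed
  have "(\<Sum>S\<in>swings w c. fact (card S) * fact (length w - card S - 1))
      = (\<Sum>T\<in>Pow small. ?f (card T))"
    unfolding swings_large[OF d]
    by (subst sum.reindex[OF inj], rule sum.cong) (use dsmall finT in auto)
  also have "\<dots> = (\<Sum>m\<le>2 * n - 1. real ((2 * n - 1) choose m) * ?f m)"
    by (subst sum_Pow_card) simp_all
  also have "\<dots> = (\<Sum>m<2 * n. fact (2 * n - 1) * (if m < n then real m + 1 else 2 * real n - real m))"
  proof (rule sum.cong)
    show "{..2 * n - 1} = {..<2 * n}" using n_pos by auto
    fix m assume "m \<in> {..<2 * n}"
    \<comment> \<open>The successor form splits off the factor \<open>2 * n - m\<close> from
      \<open>fact (2 * n - m)\<close>, so that \<open>P\<close> applies when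
      \<open>m \<ge> n\<close> as well.\<close>
    then have m: "m \<le> 2 * n - 1" "2 * n - m = Suc (2 * n - 1 - m)" by auto
    let ?P = "real ((2 * n - 1) choose m)" and ?r = "2 * n - 1 - m"
    have P: "fact m * fact ?r * ?P = fact (2 * n - 1)"
      using binomial_fact_lemma[OF m(1)] by (metis of_nat_fact of_nat_mult)
    have r: "real (Suc ?r) = 2 * real n - real m" using m by linarith
    show "?P * ?f m = fact (2 * n - 1) * (if m < n then real m + 1 else 2 * real n - real m)"
    proof (cases "m < n")
      case True
      have "?P * (fact (m + 1) * fact ?r) = (fact m * fact ?r * ?P) * (real m + 1)"
        by (simp add: algebra_simps)
      then have "?P * (fact (m + 1) * fact ?r) = fact (2 * n - 1) * (real m + 1)"
        by (simp only: P)
      then show ?thesis using True by (simp only: if_True)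
    next
      case False
      have "?P * (fact m * fact (Suc ?r)) = (fact m * fact ?r * ?P) * real (Suc ?r)"
        by (simp only: fact_Suc mult_ac)
      then have "?P * (fact m * fact (2 * n - m)) = fact (2 * n - 1) * (2 * real n - real m)"
        by (simp only: P r m(2))
      then show ?thesis using False by (simp only: if_False)
    qed
  qed
  also have "\<dots> = fact (2 * n - 1) * (real n * (real n + 1))"
    by (simp add: sum_distrib_left[symmetric] sum_min_reflect)
  finally have "SS_index w c = fact (2 * n - 1) * (real n * (real n + 1)) / fact (2 * n + 1)"
    using c by (subst SS_index_Shapley[OF nonneg]) (auto simp: players_w)
  also have "fact (2 * n + 1) = (2 * real n + 1) * (2 * real n) * fact (2 * n - 1)"
    using n_pos by (cases n) (simp_all add: algebra_simps)
  also have "fact (2 * n - 1) * (real n * (real n + 1)) / \<dots> = a"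
    using n_pos by (simp add: a_eq)
  finally show ?thesis .
qed

lemma primitive_fixed_point: "primitive_SS_fixed_point w"
proof -
  have idx: "SS_index w i = w ! i \<and> w ! i \<noteq> 0" if "i \<in> players w" for i
    using that unfolding players_w
    using SS_index_large nth_large SS_index_small nth_small a_pos b_pos by fastforce
  then have "SS w = w"
    unfolding SS_def by (intro nth_equalityI) (auto simp: players_def simp del: upt_Suc)
  then show ?thesis
    using idx voting_system by (simp add: primitive_SS_fixed_point_def SS_fixed_point_def)
qed

end

theorem mainTheorem6:
  shows "\<exists>K::nat. \<forall>k\<ge>K.
    (let b = (real k + 1) / (4 * (real k + 1)^2 - 1);
         a = (1 - (2 * real k + 1) * b) / 2
     in primitive_SS_fixed_point ([a, a] @ replicate (2 * k + 1) b))"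
\<comment> \<open>The witness is 0, since \<open>n = k + 1\<close> meets \<open>n \<ge> 1\<close>
  for every natural \<open>k\<close>.\<close>
proof (intro exI[of _ 0] allI impI)
  fix k :: nat
  define b where "b = (real k + 1) / (4 * (real k + 1)^2 - 1)"
  define a where "a = (1 - (2 * real k + 1) * b) / 2"
  \<comment> \<open>The factor \<open>2 * k + 1\<close> cancels from the total small weight, which
    brings \<open>a\<close> to the closed form of the locale.\<close>
  have "4 * (real k + 1)^2 - 1 = (2 * real k + 1) * (2 * real k + 3)"
    by (simp add: power2_eq_square algebra_simps)
  moreover have "2 * real k + 1 \<noteq> 0" "2 * real k + 3 \<noteq> 0" by linarith+
  ultimately have "(2 * real k + 1) * b = (real k + 1) / (2 * real k + 3)"
    by (simp add: b_def)
  then have "a = (real k + 2) / (2 * (2 * real k + 3))"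
    using \<open>2 * real k + 3 \<noteq> 0\<close> by (simp add: a_def field_simps)
  then have "two_large_players (k + 1) a b ([a, a] @ replicate (2 * k + 1) b)"
    by unfold_locales (simp_all add: b_def algebra_simps)
  then show "let b = (real k + 1) / (4 * (real k + 1)^2 - 1);
         a = (1 - (2 * real k + 1) * b) / 2
     in primitive_SS_fixed_point ([a, a] @ replicate (2 * k + 1) b)"
    unfolding Let_def a_def b_def by (rule two_large_players.primitive_fixed_point)
qed

end
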